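(* For every $\alpha = (\alpha_1,\dots,\alpha_m) \in \mathbb{Z}^m$, \[ \mathfrak{S}_\alpha = \sum_{\sigma \in S_m} (-1)^{\sigma}\, H_{\alpha_1+\sigma_1-1}\, H_{\alpha_2+\sigma_2-2}\cdots H_{\alpha_m+\sigma_m-m}, \] with the conventions $H_0=1$ and $H_{-r}=0$ for $r>0$, where $(-1)^\sigma$ is the sign of the permutation $\sigma$.
   Context: Work over $\mathbb{Q}$. $\mathrm{NSym}$ is the free associative graded algebra on generators $H_1,H_2,\dots$ ($H_i$ of degree $i$), with $H_0=1$, $H_{-r}=0$ for $r>0$. Its graded dual is $\mathrm{QSym}$ (quasisymmetric functions) via the pairing $\langle H_{\alpha_1}\cdots H_{\alpha_k}, M_\beta\rangle=\delta_{\alpha\beta}$, where $M_\beta=\sum_{i_1<\dots<i_k}x_{i_1}^{\beta_1}\cdots x_{i_k}^{\beta_k}$; the coproduct of $\mathrm{NSym}$ is $\Delta(H_j)=\sum_{i=0}^j H_i\otimes H_{j-i}$, extended multiplicatively. For $F\in\mathrm{QSym}$, $F^\perp$ is the adjoint of multiplication by $F$: $\langle F^\perp(H),G\rangle=\langle H,FG\rangle$. $F_{1^i}$ is the fundamental quasisymmetric function indexed by the composition $(1^i)$, i.e. $F_{1^i}=M_{1^i}$, $F_{1^0}=1$. For $m\in\mathbb{Z}$, $\mathbb{B}_m=\sum_{i\ge0}(-1)^iH_{m+i}F_{1^i}^\perp$, and for $\alpha\in\mathbb{Z}^m$, $\mathfrak{S}_\alpha=\mathbb{B}_{\alpha_1}\cdots\mathbb{B}_{\alpha_m}(1)$.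 *)

theory Defs
  imports Complex_Main "HOL-Library.Poly_Mapping" "HOL-Combinatorics.Permutations"
begin

section \<open>Compositions\<close>

typedef composition = "{xs :: nat list. 0 \<notin> set xs}"
  morphisms parts Comp
  by (rule exI[of _ "[]"]) simp

setup_lifting type_definition_composition

text \<open>Compositions under concatenation (written additively, as \<^theory>\<open>HOL-Library.Poly_Mapping\<close>
  requires for the index monoid of a convolution product) are the free monoid on \<open>{1, 2, \<dots>}\<close>.\<close>

instantiation composition :: monoid_add
begin

lift_definition zero_composition :: composition is "[]" by simp

lift_definition plus_composition :: "composition \<Rightarrow> composition \<Rightarrow> composition" is "(@)" by auto

instance by standard (transfer; simp)+

end

definition ones :: "nat \<Rightarrow> composition" where
  "ones i = Comp (replicate i 1)"

text \<open>As all parts are positive, the blocks below are automatically nonempty.\<close>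

definition refines :: "composition \<Rightarrow> composition \<Rightarrow> bool" where
  "refines \<beta> \<alpha> \<longleftrightarrow> (\<exists>bs. concat bs = parts \<beta> \<and> map sum_list bs = parts \<alpha>)"


section \<open>Noncommutative symmetric functions\<close>

text \<open>The algebra over the rationals of the free monoid of compositions, i.e. the free associative
  algebra on \<open>H\<^sub>1, H\<^sub>2, \<dots>\<close>. The monomial \<open>H\<^bsub>\<alpha>\<^sub>1\<^esub> \<cdots> H\<^bsub>\<alpha>\<^sub>k\<^esub>\<close> is the basis element indexed by
  \<open>\<alpha>\<close>, see \<open>prod_list_H\<close> below.\<close>

type_synonym nsym = "composition \<Rightarrow>\<^sub>0 rat"

definition H :: "int \<Rightarrow> nsym" where
  "H r = (if r < 0 then 0 else if r = 0 then 1 else Poly_Mapping.single (Comp [nat r]) 1)"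


section \<open>Quasisymmetric functions\<close>

text \<open>Formal power series in variables \<open>x\<^sub>0, x\<^sub>1, \<dots>\<close>, given by their coefficients on the monomials,
  which are represented by their exponents.\<close>

type_synonym power_series = "(nat \<Rightarrow>\<^sub>0 nat) \<Rightarrow> rat"

definition monomial_of :: "nat list \<Rightarrow> nat list \<Rightarrow> (nat \<Rightarrow>\<^sub>0 nat)" where
  "monomial_of is es = sum_list (map2 Poly_Mapping.single is es)"

definition total_degree :: "(nat \<Rightarrow>\<^sub>0 nat) \<Rightarrow> nat" where
  "total_degree x = (\<Sum>k\<in>Poly_Mapping.keys x. Poly_Mapping.lookup x k)"

definition series_mult :: "power_series \<Rightarrow> power_series \<Rightarrow> power_series" (infixl \<open>\<star>\<close> 70) where
  "f \<star> g = (\<lambda>x. \<Sum>(a, b)\<in>{(a, b). a + b = x}. f a * g b)"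

definition QSym :: "power_series set" where
  "QSym = {f. (\<exists>d. \<forall>x. f x \<noteq> 0 \<longrightarrow> total_degree x \<le> d) \<and>
    (\<forall>\<beta> is js. length is = length (parts \<beta>) \<and> length js = length (parts \<beta>) \<and>
       sorted_wrt (<) is \<and> sorted_wrt (<) js \<longrightarrow>
       f (monomial_of is (parts \<beta>)) = f (monomial_of js (parts \<beta>)))}"

text \<open>\<open>M\<^sub>\<beta> = \<Sum>\<^bsub>i\<^sub>1 < \<dots> < i\<^sub>k\<^esub> x\<^bsub>i\<^sub>1\<^esub>\<^bsup>\<beta>\<^sub>1\<^esup> \<cdots> x\<^bsub>i\<^sub>k\<^esub>\<^bsup>\<beta>\<^sub>k\<^esup>\<close>: the coefficient on a
  monomial is the number of index sequences producing it.\<close>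

definition M :: "composition \<Rightarrow> power_series" where
  "M \<beta> = (\<lambda>x. of_nat (card {is. length is = length (parts \<beta>) \<and> sorted_wrt (<) is \<and>
                               monomial_of is (parts \<beta>) = x}))"

definition fundamental :: "composition \<Rightarrow> power_series" where
  "fundamental \<alpha> = (\<lambda>x. \<Sum>\<beta> | refines \<beta> \<alpha>. M \<beta> x)"


section \<open>The pairing and the adjoint operators\<close>

definition M_coeffs :: "power_series \<Rightarrow> (composition \<Rightarrow>\<^sub>0 rat)" where
  "M_coeffs G = (THE c. G = (\<lambda>x. \<Sum>\<beta>\<in>Poly_Mapping.keys c. Poly_Mapping.lookup c \<beta> * M \<beta> x))"

text \<open>The bilinear form for which the bases \<open>H\<^bsub>\<alpha>\<^sub>1\<^esub> \<cdots> H\<^bsub>\<alpha>\<^sub>k\<^esub>\<close> and \<open>M\<^sub>\<beta>\<close> are dual,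
  see \<open>pairing_H_M\<close> below.\<close>

definition pairing :: "nsym \<Rightarrow> power_series \<Rightarrow> rat" where
  "pairing h G = (\<Sum>\<alpha>\<in>Poly_Mapping.keys h.
     Poly_Mapping.lookup h \<alpha> * Poly_Mapping.lookup (M_coeffs G) \<alpha>)"

text \<open>Existence and uniqueness for quasisymmetric \<open>F\<close> are \<open>ex1_perp\<close> below.\<close>

definition perp :: "power_series \<Rightarrow> nsym \<Rightarrow> nsym" where
  "perp F h = (THE k. \<forall>G\<in>QSym. pairing k G = pairing h (F \<star> G))"


section \<open>The immaculate functions\<close>

text \<open>The sum is over all \<open>i\<close> with a nonzero term; there are finitely many by \<open>finite_bernstein\<close>.\<close>

definition bernstein :: "int \<Rightarrow> nsym \<Rightarrow> nsym" where
  "bernstein m h = Sum_any (\<lambda>i. (- 1) ^ i * H (m + int i) * perp (fundamental (ones i)) h)"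

definition immaculate :: "int list \<Rightarrow> nsym" where
  "immaculate \<alpha> = foldr bernstein \<alpha> 1"


section \<open>Well-definedness\<close>

lemma parts_pos: "0 \<notin> set (parts \<alpha>)"
  using parts[of \<alpha>] by simp

lemma parts_ones: "parts (ones i) = replicate i 1"
  unfolding ones_def by (rule Comp_inverse) auto

lemma monomial_of_Nil [simp]: "monomial_of [] es = 0"
  by (simp add: monomial_of_def)

lemma monomial_of_Cons [simp]:
  "monomial_of (i # is) (e # es) = Poly_Mapping.single i e + monomial_of is es"
  by (simp add: monomial_of_def)

lemma lookup_monomial_of_notin:
  "k \<notin> set is \<Longrightarrow> Poly_Mapping.lookup (monomial_of is es) k = 0"
proof (induction "is" arbitrary: es)
  case (Cons i "is")
  then show ?case
    by (cases es) (auto simp: lookup_add lookup_single when_def monomial_of_def)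
qed simp

lemma map_lookup_monomial_of:
  assumes "distinct is" "length is = length es"
  shows "map (Poly_Mapping.lookup (monomial_of is es)) is = es"
  using assms(2,1)
proof (induction "is" es rule: list_induct2)
  case (Cons i "is" e es)
  have "\<forall>k\<in>set is. Poly_Mapping.lookup (monomial_of (i # is) (e # es)) k
      = Poly_Mapping.lookup (monomial_of is es) k"
    using Cons.prems by (auto simp: lookup_add lookup_single when_def)
  then have "map (Poly_Mapping.lookup (monomial_of (i # is) (e # es))) is
      = map (Poly_Mapping.lookup (monomial_of is es)) is"
    by (simp only: map_eq_conv)
  moreover have "Poly_Mapping.lookup (monomial_of (i # is) (e # es)) i = e"
    using Cons.prems by (simp add: lookup_add lookup_monomial_of_notin)
  ultimately show ?case
    using Cons by (simp del: monomial_of_Cons map_eq_conv)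
qed simp

lemma keys_monomial_of:
  assumes "distinct is" "length is = length es" "0 \<notin> set es"
  shows "Poly_Mapping.keys (monomial_of is es) = set is"
proof -
  have "Poly_Mapping.lookup (monomial_of is es) k \<noteq> 0" if "k \<in> set is" for k
  proof -
    have "Poly_Mapping.lookup (monomial_of is es) k
        \<in> set (map (Poly_Mapping.lookup (monomial_of is es)) is)"
      using that by simp
    then show ?thesis
      using assms map_lookup_monomial_of[OF assms(1,2)] by metis
  qed
  then show ?thesis
    using lookup_monomial_of_notin[of _ "is" es] by (auto simp: in_keys_iff)
qed

lemma monomial_of_lookup:
  assumes "distinct is" "Poly_Mapping.keys x \<subseteq> set is"
  shows "monomial_of is (map (Poly_Mapping.lookup x) is) = x"
proof (rule poly_mapping_eqI)
  fix k
  let ?m = "monomial_of is (map (Poly_Mapping.lookup x) is)"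
  have eq: "map (Poly_Mapping.lookup ?m) is = map (Poly_Mapping.lookup x) is"
    by (rule map_lookup_monomial_of) (use assms in auto)
  show "Poly_Mapping.lookup ?m k = Poly_Mapping.lookup x k"
  proof (cases "k \<in> set is")
    case True
    then show ?thesis using eq by (simp only: map_eq_conv)
  next
    case False
    then show ?thesis using assms(2)
      by (metis in_keys_iff lookup_monomial_of_notin subsetD)
  qed
qed

lemma monomial_of_inject:
  assumes "sorted_wrt (<) is" "length is = length es" "0 \<notin> set es"
    and "sorted_wrt (<) js" "length js = length fs" "0 \<notin> set fs"
    and "monomial_of is es = monomial_of js fs"
  shows "is = js" "es = fs"
proof -
  have d: "distinct is" "distinct js"
    using assms strict_sorted_iff by auto
  have "set is = set js"
    using keys_monomial_of[OF d(1) assms(2,3)] keys_monomial_of[OF d(2) assms(5,6)]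
    by (simp only: assms(7))
  then show "is = js"
    by (rule strict_sorted_equal[OF assms(4,1)])
  then have "map (Poly_Mapping.lookup (monomial_of is es)) is
      = map (Poly_Mapping.lookup (monomial_of js fs)) js"
    unfolding assms(7) by simp
  then show "es = fs"
    by (simp only: map_lookup_monomial_of d assms(2,5))
qed

lemma monomial_of_cases:
  obtains "is" \<beta> where "sorted_wrt (<) is" "length is = length (parts \<beta>)"
    "x = monomial_of is (parts \<beta>)"
proof -
  define js where "js = sorted_list_of_set (Poly_Mapping.keys x)"
  define es where "es = map (Poly_Mapping.lookup x) js"
  have s: "set js = Poly_Mapping.keys x" "sorted_wrt (<) js"
    by (auto simp: js_def)
  then have "0 \<notin> set es"
    by (auto simp: es_def in_keys_iff)
  then have p: "parts (Comp es) = es"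
    by (simp add: Comp_inverse)
  have mon: "monomial_of js es = x"
    unfolding es_def by (rule monomial_of_lookup) (use s strict_sorted_iff in auto)
  have len: "length js = length es"
    by (simp add: es_def)
  show ?thesis
    by (rule that[OF s(2), of "Comp es"]) (simp_all only: p mon len)
qed

lemma M_monomial_of:
  assumes "sorted_wrt (<) is" "length is = length (parts \<gamma>)"
  shows "M \<beta> (monomial_of is (parts \<gamma>)) = of_bool (\<beta> = \<gamma>)"
proof -
  have "{js. length js = length (parts \<beta>) \<and> sorted_wrt (<) js \<and>
           monomial_of js (parts \<beta>) = monomial_of is (parts \<gamma>)} = (if \<beta> = \<gamma> then {is} else {})"
    using monomial_of_inject[of _ "parts \<beta>" "is" "parts \<gamma>"] assms parts_pos
    by (auto simp: parts_inject)
  then show ?thesis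
    by (simp add: M_def)
qed

definition canonical :: "composition \<Rightarrow> (nat \<Rightarrow>\<^sub>0 nat)" where
  "canonical \<beta> = monomial_of [0..<length (parts \<beta>)] (parts \<beta>)"

lemma M_canonical: "M \<beta> (canonical \<gamma>) = of_bool (\<beta> = \<gamma>)"
  unfolding canonical_def by (rule M_monomial_of) auto

lemma QSym_canonical:
  assumes "f \<in> QSym" "sorted_wrt (<) is" "length is = length (parts \<beta>)"
  shows "f (monomial_of is (parts \<beta>)) = f (canonical \<beta>)"
proof -
  have "\<forall>\<beta> is js. length is = length (parts \<beta>) \<and> length js = length (parts \<beta>) \<and>
       sorted_wrt (<) is \<and> sorted_wrt (<) js \<longrightarrow>
       f (monomial_of is (parts \<beta>)) = f (monomial_of js (parts \<beta>))"
    using assms(1) unfolding QSym_def by (rule CollectE) (erule conjunct2)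
  from this[rule_format, of "is" \<beta> "[0..<length (parts \<beta>)]"] show ?thesis
    using assms(2,3) by (simp add: canonical_def)
qed

lemma total_degree_add: "total_degree (a + b) = total_degree a + total_degree b"
proof -
  let ?K = "Poly_Mapping.keys a \<union> Poly_Mapping.keys b"
  have "total_degree x = (\<Sum>k\<in>?K. Poly_Mapping.lookup x k)"
    if "Poly_Mapping.keys x \<subseteq> ?K" for x
    unfolding total_degree_def
    by (rule sum.mono_neutral_left) (use that in \<open>auto simp: in_keys_iff\<close>)
  note this[of "a + b", OF Poly_Mapping.keys_add] this[of a] this[of b]
  then show ?thesis
    by (simp add: lookup_add sum.distrib)
qed

lemma total_degree_monomial_of:
  "length is = length es \<Longrightarrow> total_degree (monomial_of is es) = sum_list es"
proof (induction "is" es rule: list_induct2)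
  case Nil
  then show ?case by (simp add: total_degree_def)
next
  case (Cons i "is" e es)
  have "total_degree (Poly_Mapping.single i e) = e"
    by (simp add: total_degree_def)
  then show ?case
    using Cons by (simp add: total_degree_add)
qed

lemma total_degree_canonical: "total_degree (canonical \<beta>) = sum_list (parts \<beta>)"
  by (simp add: canonical_def total_degree_monomial_of)

lemma finite_compositions: "finite {\<beta>. sum_list (parts \<beta>) \<le> d}"
proof -
  have len: "length xs \<le> sum_list xs" if "0 \<notin> set xs" for xs :: "nat list"
    using that by (induction xs) auto
  have "parts ` {\<beta>. sum_list (parts \<beta>) \<le> d} \<subseteq> {xs. set xs \<subseteq> {..d} \<and> length xs \<le> d}"
    using len[OF parts_pos] by (auto intro: order_trans member_le_sum_list)
  then have "finite (parts ` {\<beta>. sum_list (parts \<beta>) \<le> d})"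
    by (rule finite_subset) (simp add: finite_lists_length_le)
  then show ?thesis
    by (rule finite_imageD) (simp add: inj_on_def parts_inject)
qed

lemma total_degree_M:
  assumes "M \<beta> x \<noteq> 0"
  shows "total_degree x = sum_list (parts \<beta>)"
proof -
  obtain "is" \<gamma> where "sorted_wrt (<) is" "length is = length (parts \<gamma>)"
    "x = monomial_of is (parts \<gamma>)"
    by (rule monomial_of_cases)
  then show ?thesis
    using assms M_monomial_of[of "is" \<gamma> \<beta>]
    by (cases "\<beta> = \<gamma>") (auto simp: total_degree_monomial_of)
qed

lemma M_in_QSym: "M \<beta> \<in> QSym"
  unfolding QSym_def
proof (intro CollectI conjI allI impI)
  show "\<exists>d. \<forall>x. M \<beta> x \<noteq> 0 \<longrightarrow> total_degree x \<le> d"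
    using total_degree_M by (intro exI[of _ "sum_list (parts \<beta>)"]) simp
qed (simp add: M_monomial_of)

lemma M_expansion:
  assumes "\<And>x. G x = (\<Sum>\<beta>\<in>Poly_Mapping.keys c. Poly_Mapping.lookup c \<beta> * M \<beta> x)"
  shows "Poly_Mapping.lookup c \<gamma> = G (canonical \<gamma>)"
proof -
  have "G (canonical \<gamma>) = (\<Sum>\<beta>\<in>Poly_Mapping.keys c. if \<beta> = \<gamma> then Poly_Mapping.lookup c \<beta> else 0)"
    unfolding assms M_canonical by (rule sum.cong) auto
  then show ?thesis
    by (simp add: in_keys_iff)
qed

lemma ex_M_expansion:
  assumes "G \<in> QSym"
  obtains c where "\<And>\<beta>. Poly_Mapping.lookup c \<beta> = G (canonical \<beta>)"
    "G = (\<lambda>x. \<Sum>\<beta>\<in>Poly_Mapping.keys c. Poly_Mapping.lookup c \<beta> * M \<beta> x)"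
proof -
  obtain d where d: "\<And>x. G x \<noteq> 0 \<Longrightarrow> total_degree x \<le> d"
    using assms by (auto simp: QSym_def)
  have "finite {\<beta>. G (canonical \<beta>) \<noteq> 0}"
    by (rule finite_subset[OF _ finite_compositions[of d]])
       (use d in \<open>auto simp flip: total_degree_canonical\<close>)
  then obtain c where c: "\<And>\<beta>. Poly_Mapping.lookup c \<beta> = G (canonical \<beta>)"
    by (metis Abs_poly_mapping_inverse mem_Collect_eq)
  have "G x = (\<Sum>\<beta>\<in>Poly_Mapping.keys c. Poly_Mapping.lookup c \<beta> * M \<beta> x)" for x
  proof -
    obtain "is" \<gamma> where x: "sorted_wrt (<) is" "length is = length (parts \<gamma>)"
      "x = monomial_of is (parts \<gamma>)"
      by (rule monomial_of_cases)
    have "(\<Sum>\<beta>\<in>Poly_Mapping.keys c. Poly_Mapping.lookup c \<beta> * M \<beta> x)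
        = (\<Sum>\<beta>\<in>Poly_Mapping.keys c. if \<beta> = \<gamma> then Poly_Mapping.lookup c \<beta> else 0)"
      unfolding x(3) M_monomial_of[OF x(1,2)] by (rule sum.cong) auto
    also have "\<dots> = Poly_Mapping.lookup c \<gamma>"
      by (simp add: in_keys_iff)
    finally show ?thesis
      using QSym_canonical[OF assms x(1,2)] by (simp add: c x(3))
  qed
  then show ?thesis
    using c that by blast
qed

lemma M_coeffs:
  assumes "G \<in> QSym"
  shows "G = (\<lambda>x. \<Sum>\<beta>\<in>Poly_Mapping.keys (M_coeffs G). Poly_Mapping.lookup (M_coeffs G) \<beta> * M \<beta> x)"
    and "Poly_Mapping.lookup (M_coeffs G) \<beta> = G (canonical \<beta>)"
proof -
  obtain c where c: "\<And>\<beta>. Poly_Mapping.lookup c \<beta> = G (canonical \<beta>)"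
    "G = (\<lambda>x. \<Sum>\<beta>\<in>Poly_Mapping.keys c. Poly_Mapping.lookup c \<beta> * M \<beta> x)"
    using ex_M_expansion[OF assms] by blast
  have coeffs: "M_coeffs G = c"
    unfolding M_coeffs_def
  proof (rule the_equality)
    show "G = (\<lambda>x. \<Sum>\<beta>\<in>Poly_Mapping.keys c. Poly_Mapping.lookup c \<beta> * M \<beta> x)"
      by (rule c(2))
    fix c' assume eq: "G = (\<lambda>x. \<Sum>\<beta>\<in>Poly_Mapping.keys c'. Poly_Mapping.lookup c' \<beta> * M \<beta> x)"
    have "Poly_Mapping.lookup c' \<gamma> = G (canonical \<gamma>)" for \<gamma>
      by (rule M_expansion) (subst eq, rule refl)
    then show "c' = c"
      by (intro poly_mapping_eqI) (simp only: c(1))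
  qed
  show "G = (\<lambda>x. \<Sum>\<beta>\<in>Poly_Mapping.keys (M_coeffs G). Poly_Mapping.lookup (M_coeffs G) \<beta> * M \<beta> x)"
    unfolding coeffs by (rule c(2))
  show "Poly_Mapping.lookup (M_coeffs G) \<beta> = G (canonical \<beta>)"
    unfolding coeffs by (rule c(1))
qed

lemma pairing_QSym:
  assumes "G \<in> QSym" "finite A" "Poly_Mapping.keys h \<subseteq> A"
  shows "pairing h G = (\<Sum>\<alpha>\<in>A. Poly_Mapping.lookup h \<alpha> * G (canonical \<alpha>))"
  unfolding pairing_def M_coeffs(2)[OF assms(1)]
  by (rule sum.mono_neutral_left) (use assms in \<open>auto simp: in_keys_iff\<close>)

lemma prod_list_H:
  "prod_list (map (\<lambda>i. H (int i)) (parts \<alpha>)) = Poly_Mapping.single \<alpha> 1"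
proof -
  have "prod_list (map (\<lambda>i. H (int i)) xs) = Poly_Mapping.single (Comp xs) 1"
    if "0 \<notin> set xs" for xs
    using that
  proof (induction xs)
    case Nil
    have "Comp [] = 0"
      by (simp add: zero_composition_def)
    then show ?case by simp
  next
    case (Cons x xs)
    have "Comp [x] + Comp xs = Comp (x # xs)"
      using Cons.prems by (simp add: plus_composition_def Comp_inverse)
    then show ?case
      using Cons by (simp add: H_def mult_single)
  qed
  from this[OF parts_pos] show ?thesis
    by (simp add: parts_inverse)
qed

lemma pairing_H_M:
  "pairing (prod_list (map (\<lambda>i. H (int i)) (parts \<alpha>))) (M \<beta>) = of_bool (\<alpha> = \<beta>)"
  unfolding prod_list_H
  by (subst pairing_QSym[of _ "{\<alpha>}"]) (auto simp: M_in_QSym M_canonical)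

lemma pairing_add_left: "pairing (h + k) G = pairing h G + pairing k G"
proof -
  let ?A = "Poly_Mapping.keys h \<union> Poly_Mapping.keys k"
  have "pairing l G = (\<Sum>\<alpha>\<in>?A. Poly_Mapping.lookup l \<alpha> * Poly_Mapping.lookup (M_coeffs G) \<alpha>)"
    if "Poly_Mapping.keys l \<subseteq> ?A" for l
    unfolding pairing_def by (rule sum.mono_neutral_left) (use that in \<open>auto simp: in_keys_iff\<close>)
  note this[of "h + k", OF Poly_Mapping.keys_add] this[of h] this[of k]
  then show ?thesis
    by (simp add: lookup_add distrib_right sum.distrib)
qed

lemma finite_splittings: "finite {(a, b). a + b = (x :: nat \<Rightarrow>\<^sub>0 nat)}"
proof -
  define js where "js = sorted_list_of_set (Poly_Mapping.keys x)"
  have js: "set js = Poly_Mapping.keys x" "distinct js"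
    by (auto simp: js_def)
  let ?S = "{es. set es \<subseteq> {..total_degree x} \<and> length es = length js}"
  have fin: "finite (monomial_of js ` ?S)"
    by (intro finite_imageI finite_lists_length_eq) simp
  have mem: "a \<in> monomial_of js ` ?S" if "a + b = x" for a b
  proof -
    have le: "Poly_Mapping.lookup a k \<le> Poly_Mapping.lookup x k" for k
      using that by (auto simp: lookup_add)
    have bound: "Poly_Mapping.lookup x k \<le> total_degree x" for k
      unfolding total_degree_def
      by (cases "k \<in> Poly_Mapping.keys x") (auto intro: member_le_sum simp: in_keys_iff)
    have "Poly_Mapping.keys a \<subseteq> set js"
      using le unfolding js by (metis in_keys_iff le_zero_eq subsetI)
    then have "a = monomial_of js (map (Poly_Mapping.lookup a) js)"
      using js by (simp add: monomial_of_lookup)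
    moreover have "map (Poly_Mapping.lookup a) js \<in> ?S"
      using le bound order_trans by fastforce
    ultimately show ?thesis by (rule image_eqI)
  qed
  have "{(a, b). a + b = x} \<subseteq> monomial_of js ` ?S \<times> monomial_of js ` ?S"
    using mem add.commute by fastforce
  then show ?thesis
    using fin finite_subset by blast
qed

lemma QSym_monomial_of:
  assumes f: "f \<in> QSym" and "is": "sorted_wrt (<) is" "length is = length es"
    and js: "sorted_wrt (<) js" "length js = length es"
  shows "f (monomial_of is es) = f (monomial_of js es)"
proof -
  define sub where "sub = (\<lambda>ks. map fst (filter (\<lambda>p. snd p \<noteq> 0) (zip ks es)) :: nat list)"
  define \<beta> where "\<beta> = Comp (filter (\<lambda>e. e \<noteq> 0) es)"
  have \<beta>: "parts \<beta> = filter (\<lambda>e. e \<noteq> 0) es"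
    unfolding \<beta>_def by (rule Comp_inverse) simp
  have len: "length (sub ks) = length (parts \<beta>)" if "length ks = length es" for ks
    using that unfolding sub_def \<beta> by (induction ks es rule: list_induct2) auto
  have mon: "monomial_of ks es = monomial_of (sub ks) (parts \<beta>)" if "length ks = length es" for ks
    using that unfolding sub_def \<beta> by (induction ks es rule: list_induct2) auto
  have sorted: "sorted_wrt (<) (sub ks)" if "sorted_wrt (<) ks" "length ks = length es" for ks
  proof -
    have "sorted_wrt (<) (map fst (zip ks es))"
      using that by simp
    then show ?thesis
      unfolding sub_def sorted_wrt_map by (rule sorted_wrt_filter)
  qed
  show ?thesis
    unfolding mon[OF "is"(2)] mon[OF js(2)]
    using QSym_canonical[OF f] sorted len "is" js by metis
qed

lemma series_mult_monomial_of:
  assumes "distinct is" "length is = length es"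
  shows "(f \<star> g) (monomial_of is es) =
    (\<Sum>(u, v)\<in>{(u, v). length u = length es \<and> length v = length es \<and> map2 (+) u v = es}.
       f (monomial_of is u) * g (monomial_of is v))"
  unfolding series_mult_def
proof (rule sum.reindex_bij_witness[where
      i = "\<lambda>(u, v). (monomial_of is u, monomial_of is v)" and
      j = "\<lambda>(a, b). (map (Poly_Mapping.lookup a) is, map (Poly_Mapping.lookup b) is)"])
  let ?x = "monomial_of is es"
  fix p assume "p \<in> {(a, b). a + b = ?x}"
  then obtain a b where p: "p = (a, b)" "a + b = ?x" by auto
  have "Poly_Mapping.lookup a k + Poly_Mapping.lookup b k = Poly_Mapping.lookup ?x k" for k
    using p(2) by (metis lookup_add)
  then have "Poly_Mapping.lookup a k = 0 \<and> Poly_Mapping.lookup b k = 0" if "k \<notin> set is" for k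
    using lookup_monomial_of_notin[OF that, of es] by (metis add_is_0)
  then have "Poly_Mapping.keys a \<subseteq> set is" "Poly_Mapping.keys b \<subseteq> set is"
    by (meson in_keys_iff subsetI)+
  then have ab: "monomial_of is (map (Poly_Mapping.lookup a) is) = a"
    "monomial_of is (map (Poly_Mapping.lookup b) is) = b"
    using assms(1) by (auto intro: monomial_of_lookup)
  then show "(case case p of (a, b) \<Rightarrow> (map (Poly_Mapping.lookup a) is, map (Poly_Mapping.lookup b) is) of
      (u, v) \<Rightarrow> (monomial_of is u, monomial_of is v)) = p"
    and "(case case p of (a, b) \<Rightarrow> (map (Poly_Mapping.lookup a) is, map (Poly_Mapping.lookup b) is) of
      (u, v) \<Rightarrow> f (monomial_of is u) * g (monomial_of is v)) = (case p of (a, b) \<Rightarrow> f a * g b)"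
    by (simp_all add: p)
  have "map2 (+) (map (Poly_Mapping.lookup a) is) (map (Poly_Mapping.lookup b) is)
      = map (Poly_Mapping.lookup ?x) is"
    unfolding p(2)[symmetric] by (induction "is") (auto simp: lookup_add)
  also have "\<dots> = es"
    by (rule map_lookup_monomial_of[OF assms])
  finally show "(case p of (a, b) \<Rightarrow> (map (Poly_Mapping.lookup a) is, map (Poly_Mapping.lookup b) is))
      \<in> {(u, v). length u = length es \<and> length v = length es \<and> map2 (+) u v = es}"
    using assms by (simp add: p)
next
  fix q assume "q \<in> {(u, v). length u = length es \<and> length v = length es \<and> map2 (+) u v = es}"
  then obtain u v where q: "q = (u, v)" "length u = length es" "length v = length es"
    "map2 (+) u v = es" by auto
  show "(case case q of (u, v) \<Rightarrow> (monomial_of is u, monomial_of is v) of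
      (a, b) \<Rightarrow> (map (Poly_Mapping.lookup a) is, map (Poly_Mapping.lookup b) is)) = q"
    using assms q by (simp add: map_lookup_monomial_of)
  have "length is = length u" "length u = length v"
    using assms q by auto
  then have "monomial_of is (map2 (+) u v) = monomial_of is u + monomial_of is v"
    by (induction "is" u v rule: list_induct3) (auto simp: single_add algebra_simps)
  then show "(case q of (u, v) \<Rightarrow> (monomial_of is u, monomial_of is v)) \<in> {(a, b). a + b = monomial_of is es}"
    using q by simp
qed

lemma series_mult_nonzero:
  assumes "(f \<star> g) x \<noteq> 0"
  obtains a b where "a + b = x" "f a \<noteq> 0" "g b \<noteq> 0"
proof -
  obtain p where "p \<in> {(a, b). a + b = x}" "(case p of (a, b) \<Rightarrow> f a * g b) \<noteq> 0"
    using assms unfolding series_mult_def by (meson sum.not_neutral_contains_not_neutral)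
  then show ?thesis
    using that by (cases p) auto
qed

lemma series_mult_in_QSym:
  assumes "f \<in> QSym" "g \<in> QSym"
  shows "f \<star> g \<in> QSym"
proof -
  obtain d e where d: "\<And>x. f x \<noteq> 0 \<Longrightarrow> total_degree x \<le> d"
    and e: "\<And>x. g x \<noteq> 0 \<Longrightarrow> total_degree x \<le> e"
    using assms unfolding QSym_def by blast
  have "total_degree x \<le> d + e" if nz: "(f \<star> g) x \<noteq> 0" for x
  proof -
    obtain a b where "a + b = x" "f a \<noteq> 0" "g b \<noteq> 0"
      using series_mult_nonzero[OF nz] by blast
    then show ?thesis
      using d[of a] e[of b] total_degree_add[of a b] by simp
  qed
  moreover have "(f \<star> g) (monomial_of is (parts \<beta>)) = (f \<star> g) (monomial_of js (parts \<beta>))"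
    if "length is = length (parts \<beta>)" "length js = length (parts \<beta>)"
      "sorted_wrt (<) is" "sorted_wrt (<) js" for \<beta> "is" js
  proof -
    have d: "distinct is" "distinct js"
      using that strict_sorted_iff by auto
    show ?thesis
      unfolding series_mult_monomial_of[OF d(1) that(1)] series_mult_monomial_of[OF d(2) that(2)]
    proof (rule sum.cong[OF refl], clarify)
      fix u v :: "nat list"
      assume len: "length u = length (parts \<beta>)" "length v = length (parts \<beta>)"
      have "f (monomial_of is u) = f (monomial_of js u)"
        by (rule QSym_monomial_of[OF assms(1)]) (simp_all add: that len)
      moreover have "g (monomial_of is v) = g (monomial_of js v)"
        by (rule QSym_monomial_of[OF assms(2)]) (simp_all add: that len)
      ultimately show "f (monomial_of is u) * g (monomial_of is v) = f (monomial_of js u) * g (monomial_of js v)"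
        by simp
    qed
  qed
  ultimately show ?thesis
    unfolding QSym_def by blast
qed

lemma series_mult_sum_right:
  "(f \<star> (\<lambda>x. \<Sum>\<beta>\<in>A. c \<beta> * g \<beta> x)) x = (\<Sum>\<beta>\<in>A. c \<beta> * (f \<star> g \<beta>) x)"
proof -
  have "(f \<star> (\<lambda>x. \<Sum>\<beta>\<in>A. c \<beta> * g \<beta> x)) x
      = (\<Sum>p\<in>{(a, b). a + b = x}. \<Sum>\<beta>\<in>A. c \<beta> * (f (fst p) * g \<beta> (snd p)))"
    unfolding series_mult_def
    by (rule sum.cong) (auto simp: sum_distrib_left mult.left_commute)
  also have "\<dots> = (\<Sum>\<beta>\<in>A. \<Sum>p\<in>{(a, b). a + b = x}. c \<beta> * (f (fst p) * g \<beta> (snd p)))"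
    by (rule sum.swap)
  finally show ?thesis
    unfolding series_mult_def sum_distrib_left by (simp add: case_prod_beta)
qed

lemma series_mult_M_canonical:
  assumes "(f \<star> M \<beta>) (canonical \<gamma>) \<noteq> 0"
  shows "sum_list (parts \<beta>) \<le> sum_list (parts \<gamma>)"
proof -
  obtain a b where "a + b = canonical \<gamma>" "M \<beta> b \<noteq> 0"
    using series_mult_nonzero[OF assms] by blast
  then show ?thesis
    using total_degree_M[of \<beta> b] total_degree_add[of a b] total_degree_canonical[of \<gamma>] by simp
qed

lemma nsym_eqI:
  assumes "\<And>G. G \<in> QSym \<Longrightarrow> pairing h G = pairing k G"
  shows "h = k"
proof (rule poly_mapping_eqI)
  fix \<beta>
  have lookup: "pairing l (M \<beta>) = Poly_Mapping.lookup l \<beta>" for l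
  proof -
    have "pairing l (M \<beta>) = (\<Sum>\<alpha>\<in>Poly_Mapping.keys l. Poly_Mapping.lookup l \<alpha> * M \<beta> (canonical \<alpha>))"
      by (rule pairing_QSym) (simp_all add: M_in_QSym)
    also have "\<dots> = (\<Sum>\<alpha>\<in>Poly_Mapping.keys l. if \<alpha> = \<beta> then Poly_Mapping.lookup l \<alpha> else 0)"
      by (rule sum.cong) (auto simp: M_canonical)
    finally show ?thesis
      by (simp add: in_keys_iff)
  qed
  show "Poly_Mapping.lookup h \<beta> = Poly_Mapping.lookup k \<beta>"
    using assms[OF M_in_QSym, of \<beta>] by (simp only: lookup)
qed

theorem ex1_perp:
  assumes F: "F \<in> QSym"
  shows "\<exists>!k. \<forall>G\<in>QSym. pairing k G = pairing h (F \<star> G)"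
proof -
  define c where "c = (\<lambda>\<beta>. pairing h (F \<star> M \<beta>))"
  have c: "c \<beta> = (\<Sum>\<alpha>\<in>Poly_Mapping.keys h. Poly_Mapping.lookup h \<alpha> * (F \<star> M \<beta>) (canonical \<alpha>))"
    for \<beta>
    unfolding c_def by (rule pairing_QSym) (simp_all add: series_mult_in_QSym F M_in_QSym)
  have "{\<beta>. c \<beta> \<noteq> 0} \<subseteq> (\<Union>\<alpha>\<in>Poly_Mapping.keys h. {\<beta>. sum_list (parts \<beta>) \<le> sum_list (parts \<alpha>)})"
  proof
    fix \<beta> assume "\<beta> \<in> {\<beta>. c \<beta> \<noteq> 0}"
    then obtain \<alpha> where "\<alpha> \<in> Poly_Mapping.keys h" "(F \<star> M \<beta>) (canonical \<alpha>) \<noteq> 0"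
      unfolding c by (auto elim!: sum.not_neutral_contains_not_neutral)
    then show "\<beta> \<in> (\<Union>\<alpha>\<in>Poly_Mapping.keys h. {\<beta>. sum_list (parts \<beta>) \<le> sum_list (parts \<alpha>)})"
      using series_mult_M_canonical by blast
  qed
  then have "finite {\<beta>. c \<beta> \<noteq> 0}"
    by (rule finite_subset) (simp add: finite_compositions)
  then obtain k where k: "\<And>\<beta>. Poly_Mapping.lookup k \<beta> = c \<beta>"
    by (metis Abs_poly_mapping_inverse mem_Collect_eq)
  have "pairing k G = pairing h (F \<star> G)" if G: "G \<in> QSym" for G
  proof -
    obtain g where g: "\<And>\<beta>. Poly_Mapping.lookup g \<beta> = G (canonical \<beta>)"
      "G = (\<lambda>x. \<Sum>\<beta>\<in>Poly_Mapping.keys g. Poly_Mapping.lookup g \<beta> * M \<beta> x)"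
      using ex_M_expansion[OF G] by blast
    have FG: "(F \<star> G) x = (\<Sum>\<beta>\<in>Poly_Mapping.keys g. Poly_Mapping.lookup g \<beta> * (F \<star> M \<beta>) x)" for x
      by (subst g(2)) (rule series_mult_sum_right)
    have "pairing h (F \<star> G)
        = (\<Sum>\<alpha>\<in>Poly_Mapping.keys h. Poly_Mapping.lookup h \<alpha> * (F \<star> G) (canonical \<alpha>))"
      by (rule pairing_QSym) (simp_all add: series_mult_in_QSym F G)
    also have "\<dots> = (\<Sum>\<alpha>\<in>Poly_Mapping.keys h. \<Sum>\<beta>\<in>Poly_Mapping.keys g.
        Poly_Mapping.lookup g \<beta> * (Poly_Mapping.lookup h \<alpha> * (F \<star> M \<beta>) (canonical \<alpha>)))"
      by (simp add: FG sum_distrib_left mult.left_commute)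
    also have "\<dots> = (\<Sum>\<beta>\<in>Poly_Mapping.keys g. Poly_Mapping.lookup g \<beta> * c \<beta>)"
      unfolding c sum_distrib_left by (rule sum.swap)
    also have "\<dots> = (\<Sum>\<beta>\<in>Poly_Mapping.keys g \<union> Poly_Mapping.keys k. Poly_Mapping.lookup g \<beta> * c \<beta>)"
      by (rule sum.mono_neutral_left) (auto simp: in_keys_iff)
    also have "\<dots> = pairing k G"
      by (subst pairing_QSym[OF G, of "Poly_Mapping.keys g \<union> Poly_Mapping.keys k"])
         (auto simp: k g(1) mult.commute)
    finally show ?thesis by simp
  qed
  then show ?thesis
    by (intro ex1I[of _ k] ballI nsym_eqI) simp_all
qed

lemma pairing_perp:
  assumes "F \<in> QSym" "G \<in> QSym"
  shows "pairing (perp F h) G = pairing h (F \<star> G)"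
  unfolding perp_def by (rule bspec[OF theI'[OF ex1_perp[OF assms(1)]] assms(2)])

lemma fundamental_ones: "fundamental (ones i) = M (ones i)"
proof -
  have single: "b = [1]" if "sum_list b = 1" "0 \<notin> set b" for b :: "nat list"
  proof (cases b)
    case (Cons x xs)
    then have "x = 1" "sum_list xs = 0"
      using that by (auto simp: add_is_1)
    then show ?thesis
      using that Cons by (cases xs) auto
  qed (use that in simp)
  have all: "concat bs = replicate i 1"
    if "map sum_list bs = replicate i 1" "0 \<notin> set (concat bs)" for bs :: "nat list list" and i
    using that
  proof (induction bs arbitrary: i)
    case (Cons b bs)
    then obtain j where "i = Suc j" by (cases i) auto
    then show ?case
      using Cons single[of b] by auto
  qed auto
  have "refines \<beta> (ones i) \<longleftrightarrow> \<beta> = ones i" for \<beta>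
  proof
    assume "refines \<beta> (ones i)"
    then show "\<beta> = ones i"
      unfolding refines_def parts_ones using all parts_pos[of \<beta>]
      by (metis parts_inject parts_ones)
  next
    assume "\<beta> = ones i"
    then show "refines \<beta> (ones i)"
      unfolding refines_def parts_ones
      by (intro exI[of _ "replicate i [1]"]) (induction i, auto simp: parts_ones)
  qed
  then show ?thesis
    by (simp add: fundamental_def)
qed

lemma finite_bernstein:
  "finite {i. (- 1) ^ i * H (m + int i) * perp (fundamental (ones i)) h \<noteq> 0}"
proof -
  define d where "d = Max (insert 0 ((\<lambda>\<alpha>. sum_list (parts \<alpha>)) ` Poly_Mapping.keys h))"
  have zero: "perp (fundamental (ones i)) h = 0" if i: "i > d" for i
  proof (rule nsym_eqI)
    fix G assume G: "G \<in> QSym"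
    have "(M (ones i) \<star> G) (canonical \<alpha>) = 0" if "\<alpha> \<in> Poly_Mapping.keys h" for \<alpha>
    proof (rule ccontr)
      assume "(M (ones i) \<star> G) (canonical \<alpha>) \<noteq> 0"
      then obtain a b where "a + b = canonical \<alpha>" "M (ones i) a \<noteq> 0"
        by (rule series_mult_nonzero)
      then have "i \<le> sum_list (parts \<alpha>)"
        using total_degree_M[of "ones i" a] total_degree_add[of a b] total_degree_canonical[of \<alpha>]
        by (simp add: parts_ones sum_list_replicate)
      moreover have "sum_list (parts \<alpha>) \<le> d"
        unfolding d_def using that by (intro Max_ge) auto
      ultimately show False using i by simp
    qed
    then have "pairing h (M (ones i) \<star> G) = 0"
      by (subst pairing_QSym[of _ "Poly_Mapping.keys h"]) (auto simp: series_mult_in_QSym M_in_QSym G)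
    moreover have "pairing 0 G = 0"
      by (simp add: pairing_def)
    ultimately show "pairing (perp (fundamental (ones i)) h) G = pairing 0 G"
      by (simp add: fundamental_ones pairing_perp M_in_QSym G)
  qed
  have "{i. (- 1) ^ i * H (m + int i) * perp (fundamental (ones i)) h \<noteq> 0} \<subseteq> {..d}"
  proof (intro subsetI, rule ccontr)
    fix i assume "i \<in> {i. (- 1) ^ i * H (m + int i) * perp (fundamental (ones i)) h \<noteq> 0}" "i \<notin> {..d}"
    then show False
      by (simp add: zero)
  qed
  then show ?thesis
    by (rule finite_subset) simp
qed

end

theory Submission
  imports Defs
begin

text \<open>Write \<open>e\<^sub>i\<close> for the fundamental quasisymmetric function of \<open>(1, \<dots>, 1)\<close>. Since
  \<open>\<Delta>(e\<^sub>i) = \<Sum>\<^sub>j e\<^sub>j \<otimes> e\<^bsub>i-j\<^esub>\<close>, applying \<open>e\<^sub>i\<^sup>\<bottom>\<close> to a product of \<open>H\<close>'s lowers the index of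
  \<open>i\<close> of the factors by one, summed over all choices of these factors. Applied to a determinant
  in the \<open>H\<close>'s it lowers \<open>i\<close> of the columns; all choices but that of the first \<open>i\<close> columns produce
  two equal columns and vanish. Hence applying a Bernstein operator is the Laplace expansion along
  a new first row.\<close>

section \<open>Coefficients and linearity of the adjoint operators\<close>

abbreviation e_perp :: "nat \<Rightarrow> nsym \<Rightarrow> nsym" where
  "e_perp i \<equiv> perp (fundamental (ones i))"

lemma fundamental_ones_in_QSym: "fundamental (ones i) \<in> QSym"
  by (simp add: fundamental_ones M_in_QSym)

lemma pairing_M: "pairing h (M \<beta>) = Poly_Mapping.lookup h \<beta>"
proof -
  have "pairing h (M \<beta>)
      = (\<Sum>\<alpha>\<in>Poly_Mapping.keys h. if \<alpha> = \<beta> then Poly_Mapping.lookup h \<alpha> else 0)"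
    unfolding pairing_def M_coeffs(2)[OF M_in_QSym]
    by (rule sum.cong) (auto simp: M_canonical)
  then show ?thesis
    by (simp add: in_keys_iff)
qed

text \<open>Pairing with \<open>M \<beta>\<close> reads off the coefficient at \<beta>, so
  \<open>perp\<close>, which is defined by a description, can be computed coefficient by
  coefficient.\<close>

lemma lookup_perp:
  assumes "F \<in> QSym"
  shows "Poly_Mapping.lookup (perp F h) \<beta> = pairing h (F \<star> M \<beta>)"
  using pairing_perp[OF assms M_in_QSym] by (simp add: pairing_M)

lemma perp_add:
  assumes "F \<in> QSym"
  shows "perp F (h + k) = perp F h + perp F k"
  by (rule poly_mapping_eqI) (simp add: lookup_add lookup_perp assms pairing_add_left)

lemma perp_zero: "F \<in> QSym \<Longrightarrow> perp F 0 = 0"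
  using perp_add[of F 0 0] by simp

lemma perp_uminus:
  assumes "F \<in> QSym"
  shows "perp F (- h) = - perp F h"
  using perp_add[OF assms, of h "- h"] perp_zero[OF assms] by (simp add: eq_neg_iff_add_eq_0 add.commute)

lemma perp_sum:
  assumes "F \<in> QSym"
  shows "perp F (\<Sum>x\<in>A. f x) = (\<Sum>x\<in>A. perp F (f x))"
  by (induction A rule: infinite_finite_induct) (simp_all add: perp_zero perp_add assms)

section \<open>Action of \<open>e_perp\<close> on a monomial in the H's\<close>

text \<open>The factors of a split monomial may have zero exponents, which
  \<open>M_monomial_of\<close> excludes; deleting these positions reduces to that case.\<close>

lemma M_monomial_of_filter:
  assumes "sorted_wrt (<) is" "length is = length es"
  shows "M \<beta> (monomial_of is es) = of_bool (filter (\<lambda>e. e \<noteq> 0) es = parts \<beta>)"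
proof -
  define js where "js = map fst (filter (\<lambda>p. snd p \<noteq> 0) (zip is es))"
  define \<gamma> where "\<gamma> = Comp (filter (\<lambda>e. e \<noteq> 0) es)"
  have \<gamma>: "parts \<gamma> = filter (\<lambda>e. e \<noteq> 0) es"
    unfolding \<gamma>_def by (rule Comp_inverse) simp
  have "length js = length (parts \<gamma>)" "monomial_of is es = monomial_of js (parts \<gamma>)"
    using assms(2) unfolding js_def \<gamma> by (induction "is" es rule: list_induct2) auto
  moreover have "sorted_wrt (<) (map fst (zip is es))"
    using assms by simp
  then have "sorted_wrt (<) js"
    unfolding js_def sorted_wrt_map by (rule sorted_wrt_filter)
  ultimately have "M \<beta> (monomial_of is es) = of_bool (\<beta> = \<gamma>)"
    by (simp only: M_monomial_of)
  then show ?thesis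
    by (simp only: parts_inject[symmetric] \<gamma> eq_commute)
qed

text \<open>The index set of the sum in \<open>series_mult_monomial_of\<close>: u and v are the
  exponents of the two factors.\<close>

definition splittings :: "nat list \<Rightarrow> (nat list \<times> nat list) set" where
  "splittings xs = {(u, v). length u = length xs \<and> length v = length xs \<and> map2 (+) u v = xs}"

text \<open>These are the splittings for which \<open>M (ones i)\<close> has coefficient 1 at u: u
  is a 0-1 vector whose i ones mark the parts that get lowered.\<close>

definition e_splittings :: "nat \<Rightarrow> nat list \<Rightarrow> (nat list \<times> nat list) set" where
  "e_splittings i xs = {(u, v) \<in> splittings xs. filter (\<lambda>e. e \<noteq> 0) u = replicate i 1}"

lemma finite_splittings_list: "finite (splittings xs)"
proof (induction xs)
  case Nil
  have "splittings [] = {([], [])}"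
    by (auto simp: splittings_def)
  then show ?case by simp
next
  case (Cons x xs)
  have "splittings (x # xs) \<subseteq>
      (\<lambda>((a, b), (u, v)). (a # u, b # v)) ` (({..x} \<times> {..x}) \<times> splittings xs)"
  proof
    fix p assume "p \<in> splittings (x # xs)"
    then obtain a u b v where "p = (a # u, b # v)" "a + b = x" "(u, v) \<in> splittings xs"
      by (auto simp: splittings_def length_Suc_conv)
    then show "p \<in> (\<lambda>((a, b), (u, v)). (a # u, b # v)) ` (({..x} \<times> {..x}) \<times> splittings xs)"
      by (intro image_eqI[of _ _ "((a, b), (u, v))"]) auto
  qed
  then show ?case
    by (rule finite_subset) (simp add: Cons.IH)
qed

lemma finite_e_splittings: "finite (e_splittings i xs)"
  by (rule finite_subset[OF _ finite_splittings_list]) (auto simp: e_splittings_def)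

text \<open>All nonzero entries of u are 1, so x splits as 0 + x or as 1 + (x - 1). The latter uses
  up one of the i ones and needs x > 0, subtraction being truncated.\<close>

lemma e_splittings_Cons:
  assumes "x > 0"
  shows "e_splittings i (x # xs) = (\<lambda>(u, v). (0 # u, x # v)) ` e_splittings i xs \<union>
    (if i = 0 then {} else (\<lambda>(u, v). (1 # u, (x - 1) # v)) ` e_splittings (i - 1) xs)"
    (is "?L = ?R")
proof (rule set_eqI)
  fix p :: "nat list \<times> nat list"
  show "p \<in> ?L \<longleftrightarrow> p \<in> ?R"
  proof
    assume "p \<in> ?L"
    then obtain a u b v where p: "p = (a # u, b # v)" "a + b = x" "(u, v) \<in> splittings xs"
      "filter (\<lambda>e. e \<noteq> 0) (a # u) = replicate i 1"
      by (auto simp: e_splittings_def splittings_def length_Suc_conv)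
    show "p \<in> ?R"
    proof (cases "a = 0")
      case True
      then have "(u, v) \<in> e_splittings i xs" "b = x"
        using p by (auto simp: e_splittings_def)
      then show ?thesis using p(1) True by force
    next
      case False
      then obtain j where "i = Suc j"
        using p(4) by (cases i) auto
      then have "(u, v) \<in> e_splittings (i - 1) xs" "b = x - 1" "a = 1" "i \<noteq> 0"
        using p False by (auto simp: e_splittings_def)
      then show ?thesis using p(1) by force
    qed
  next
    assume "p \<in> ?R"
    then consider u v where "p = (0 # u, x # v)" "(u, v) \<in> e_splittings i xs"
      | j u v where "i = Suc j" "p = (1 # u, (x - 1) # v)" "(u, v) \<in> e_splittings j xs"
      by (cases i) auto
    then show "p \<in> ?L"
      using assms by cases (auto simp: e_splittings_def splittings_def)
  qed
qed

text \<open>The value of \<open>e_perp i\<close> on the monomial of the composition xs, by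
  \<open>e_perp_single\<close>. Parts lowered to 0 disappear because \<open>H 0\<close> is
  1.\<close>

definition e_perp_monomial :: "nat \<Rightarrow> nat list \<Rightarrow> nsym" where
  "e_perp_monomial i xs = (\<Sum>(u, v)\<in>e_splittings i xs. \<Prod>x\<leftarrow>v. H (int x))"

lemma e_perp_monomial_Cons:
  assumes "x > 0"
  shows "e_perp_monomial i (x # xs) = H (int x) * e_perp_monomial i xs +
    (if i = 0 then 0 else H (int x - 1) * e_perp_monomial (i - 1) xs)"
proof -
  let ?f = "\<lambda>(u :: nat list, v). \<Prod>x\<leftarrow>v. H (int x)"
  have *: "sum ?f ((\<lambda>(u, v). (a # u, b # v)) ` A) = H (int b) * sum ?f A" for a b A
    by (subst sum.reindex) (auto simp: inj_on_def sum_distrib_left case_prod_beta)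
  have "e_perp_monomial i (x # xs) = sum ?f ((\<lambda>(u, v). (0 # u, x # v)) ` e_splittings i xs) +
    sum ?f (if i = 0 then {} else (\<lambda>(u, v). (1 # u, (x - 1) # v)) ` e_splittings (i - 1) xs)"
    unfolding e_perp_monomial_def e_splittings_Cons[OF assms]
    by (rule sum.union_disjoint) (auto simp: finite_e_splittings)
  then show ?thesis
    using assms by (simp only: * e_perp_monomial_def) (auto simp: * of_nat_diff)
qed

lemma prod_list_H_filter:
  "(\<Prod>x\<leftarrow>xs. H (int x)) = Poly_Mapping.single (Comp (filter (\<lambda>e. e \<noteq> 0) xs)) 1"
proof -
  have "(\<Prod>x\<leftarrow>xs. H (int x)) = (\<Prod>x\<leftarrow>filter (\<lambda>e. e \<noteq> 0) xs. H (int x))"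
    by (induction xs) (auto simp: H_def)
  also have "filter (\<lambda>e. e \<noteq> 0) xs = parts (Comp (filter (\<lambda>e. e \<noteq> 0) xs))"
    by (rule Comp_inverse[symmetric]) simp
  finally show ?thesis
    by (simp only: prod_list_H)
qed

text \<open>By duality, the coefficient at \<beta> is c times that of
  \<open>M (ones i) \<star> M \<beta>\<close> at \<open>canonical \<gamma>\<close>. A splitting (u,
  v) of the exponents contributes 1 exactly if u is a 0-1 vector with i ones and v without its zeros
  is \<beta>. In \<open>single 0 c\<close> the index 0 is the empty composition, so this is the
  scalar c.\<close>

lemma e_perp_single:
  "e_perp i (Poly_Mapping.single \<gamma> c) = Poly_Mapping.single 0 c * e_perp_monomial i (parts \<gamma>)"
proof (rule poly_mapping_eqI)
  fix \<beta>
  let ?f = "\<lambda>e. e \<noteq> (0 :: nat)"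
  have inj: "Comp (filter ?f v) = \<beta> \<longleftrightarrow> filter ?f v = parts \<beta>" for v
  proof -
    have "parts (Comp (filter ?f v)) = filter ?f v"
      by (rule Comp_inverse) simp
    then show ?thesis
      by (metis parts_inject)
  qed
  have "Poly_Mapping.lookup (e_perp i (Poly_Mapping.single \<gamma> c)) \<beta>
      = c * (M (ones i) \<star> M \<beta>) (canonical \<gamma>)"
    unfolding lookup_perp[OF fundamental_ones_in_QSym]
    by (subst fundamental_ones, subst pairing_QSym[of _ "{\<gamma>}"]) (auto simp: series_mult_in_QSym M_in_QSym)
  also have "(M (ones i) \<star> M \<beta>) (canonical \<gamma>) = (\<Sum>(u, v)\<in>splittings (parts \<gamma>).
      of_bool (filter ?f u = replicate i 1) * of_bool (filter ?f v = parts \<beta>))"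
    unfolding canonical_def splittings_def
    by (subst series_mult_monomial_of)
       (auto intro!: sum.cong simp: M_monomial_of_filter parts_ones)
  also have "\<dots> = (\<Sum>(u, v)\<in>e_splittings i (parts \<gamma>). of_bool (filter ?f v = parts \<beta>))"
    by (rule sum.mono_neutral_cong_right)
       (auto simp: finite_splittings_list e_splittings_def)
  also have "c * \<dots> = Poly_Mapping.lookup
      (Poly_Mapping.single 0 c * e_perp_monomial i (parts \<gamma>)) \<beta>"
    unfolding e_perp_monomial_def sum_distrib_left lookup_sum
    by (rule sum.cong) (auto simp: prod_list_H_filter mult_single lookup_single inj when_def
        simp del: of_bool_eq_iff neq0_conv)
  finally show "Poly_Mapping.lookup (e_perp i (Poly_Mapping.single \<gamma> c)) \<beta> = \<dots>" .
qed

section \<open>Leibniz rule and products of H's\<close>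

text \<open>The coproduct of e_i leaves two terms because the adjoints of e_2, e_3, ... kill H_a. By
  linearity h may be a monomial; then a > 0 is the recursion \<open>e_perp_monomial_Cons\<close>,
  and a \<le> 0 follows from the conventions for \<open>H\<close>. All integers a are covered, as
  the determinants below have such indices.\<close>

lemma e_perp_H_mult:
  "e_perp i (H a * h) = H a * e_perp i h + (if i = 0 then 0 else H (a - 1) * e_perp (i - 1) h)"
proof -
  have single: "e_perp i (H a * Poly_Mapping.single \<gamma> c) = H a * e_perp i (Poly_Mapping.single \<gamma> c)
      + (if i = 0 then 0 else H (a - 1) * e_perp (i - 1) (Poly_Mapping.single \<gamma> c))" for \<gamma> c
  proof -
    consider "a < 0" | "a = 0" | "a > 0" by linarith
    then show ?thesis
    proof cases
      case 3
      \<comment> \<open>\<open>nsym\<close> is noncommutative, so moving the scalar past an H has to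
        be justified.\<close>
      have comm: "H b * Poly_Mapping.single 0 c = Poly_Mapping.single 0 c * H b" for b
        by (simp add: H_def mult_single)
      have parts: "parts (Comp [nat a] + \<gamma>) = nat a # parts \<gamma>"
        using 3 by (simp add: plus_composition.rep_eq Comp_inverse)
      have "e_perp i (H a * Poly_Mapping.single \<gamma> c) = e_perp i (Poly_Mapping.single (Comp [nat a] + \<gamma>) c)"
        using 3 by (simp add: H_def mult_single)
      also have "\<dots> = Poly_Mapping.single 0 c * e_perp_monomial i (nat a # parts \<gamma>)"
        by (simp only: e_perp_single parts)
      also have "\<dots> = H a * (Poly_Mapping.single 0 c * e_perp_monomial i (parts \<gamma>)) +
          (if i = 0 then 0 else H (a - 1) * (Poly_Mapping.single 0 c * e_perp_monomial (i - 1) (parts \<gamma>)))"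
        using 3 by (subst e_perp_monomial_Cons) (auto simp: distrib_left comm simp flip: mult.assoc)
      finally show ?thesis
        by (simp only: e_perp_single)
    qed (auto simp: H_def perp_zero fundamental_ones_in_QSym)
  qed
  have h: "h = (\<Sum>\<gamma>\<in>Poly_Mapping.keys h. Poly_Mapping.single \<gamma> (Poly_Mapping.lookup h \<gamma>))"
    by (rule poly_mapping_eqI)
       (auto simp: lookup_sum lookup_single when_def in_keys_iff)
  show ?thesis
    by (subst (1 2 3) h)
       (simp add: sum_distrib_left perp_sum fundamental_ones_in_QSym single sum.distrib)
qed

lemma e_perp_one: "e_perp i 1 = (if i = 0 then 1 else 0)"
proof -
  have "e_splittings i [] = (if i = 0 then {([], [])} else {})"
    by (auto simp: e_splittings_def splittings_def)
  then show ?thesis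
    using e_perp_single[of i 0 1] by (simp add: zero_composition.rep_eq e_perp_monomial_def)
qed

text \<open>Iteration of the Leibniz rule: at the head j, its first summand yields the sets U
  without j, its second one those with j. Distinctness lets U name the lowered factors by their
  labels.\<close>

lemma e_perp_prod_list:
  fixes js :: "'a list"
  assumes "distinct js"
  shows "e_perp i (\<Prod>j\<leftarrow>js. H (a j)) =
    (\<Sum>U | U \<subseteq> set js \<and> card U = i. \<Prod>j\<leftarrow>js. H (a j - of_bool (j \<in> U)))"
  using assms
proof (induction js arbitrary: i)
  case Nil
  have "{U :: 'a set. U = {} \<and> card U = i} = (if i = 0 then {{}} else {})"
    by auto
  then have "(\<Sum>U :: 'a set | U = {} \<and> card U = i. 1 :: nsym) = (if i = 0 then 1 else 0)"
    by (simp only:) simp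
  then show ?case
    by (simp add: e_perp_one)
next
  case (Cons j js)
  let ?g = "\<lambda>js U. \<Prod>j\<leftarrow>js. H (a j - of_bool (j \<in> U))"
  let ?S = "\<lambda>i. {U. U \<subseteq> set js \<and> card U = i}"
  have fin: "finite (?S k)" for k by simp
  have j: "j \<notin> U" if "U \<in> ?S k" for U k
    using that Cons.prems by auto
  have finU: "finite U" if "U \<in> ?S k" for U k
    using that finite_subset by auto
  have out: "H (a j) * sum (?g js) (?S k) = sum (?g (j # js)) (?S k)" for k
    unfolding sum_distrib_left by (rule sum.cong) (use j in auto)
  have "inj_on (insert j) (?S k)" for k
    using j by (intro inj_onI) (metis insert_ident)
  moreover have "?g (j # js) (insert j U) = H (a j - 1) * ?g js U" for U
  proof -
    have "map (\<lambda>l. H (a l - of_bool (l \<in> insert j U))) js = map (\<lambda>l. H (a l - of_bool (l \<in> U))) js"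
      using Cons.prems by (intro map_cong) auto
    then show ?thesis
      by (simp only: list.map prod_list.Cons) simp
  qed
  ultimately have "in": "H (a j - 1) * sum (?g js) (?S k) = sum (?g (j # js)) (insert j ` ?S k)" for k
    by (simp only: sum.reindex o_def sum_distrib_left)
  show ?case
  proof (cases i)
    case 0
    have "{U. U \<subseteq> set (j # js) \<and> card U = i} = {{}}" "?S i = {{}}"
      using finite_subset[of _ "set (j # js)"] by (auto simp: 0 card_eq_0_iff)
    then show ?thesis
      using Cons by (simp add: 0 e_perp_H_mult)
  next
    case (Suc k)
    have "{U. U \<subseteq> set (j # js) \<and> card U = i} = ?S i \<union> insert j ` ?S k"
    proof (intro set_eqI iffI)
      fix U assume U: "U \<in> {U. U \<subseteq> set (j # js) \<and> card U = i}"
      show "U \<in> ?S i \<union> insert j ` ?S k"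
      proof (cases "j \<in> U")
        case True
        then have "U = insert j (U - {j})" by blast
        moreover have "card (U - {j}) = k"
          using U True by (simp add: Suc)
        then have "U - {j} \<in> ?S k"
          using U by auto
        ultimately show ?thesis by blast
      next
        case False
        then show ?thesis using U by auto
      qed
    next
      fix U assume "U \<in> ?S i \<union> insert j ` ?S k"
      then consider "U \<in> ?S i" | V where "U = insert j V" "V \<in> ?S k" by blast
      then show "U \<in> {U. U \<subseteq> set (j # js) \<and> card U = i}"
      proof cases
        case 2
        then show ?thesis
          using j[OF 2(2)] finU[OF 2(2)] by (auto simp: Suc)
      qed auto
    qed
    moreover have "?S i \<inter> insert j ` ?S k = {}"
      using j by blast
    ultimately have "sum (?g (j # js)) {U. U \<subseteq> set (j # js) \<and> card U = i} =
        H (a j) * sum (?g js) (?S i) + H (a j - 1) * sum (?g js) (?S k)"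
      by (simp only: sum.union_disjoint fin finite_imageI out "in")
    then show ?thesis
      using Cons by (simp add: Suc e_perp_H_mult)
  qed
qed


section \<open>Determinants in the H's and the action of \<open>e_perp\<close> on them\<close>

text \<open>The determinant with entry \<open>H (a j + c k)\<close> in row j and column k, each
  product being taken in the order of the rows. The column labels c are kept separate from a so that
  single columns can be lowered.\<close>

definition det_H :: "nat \<Rightarrow> (nat \<Rightarrow> int) \<Rightarrow> (nat \<Rightarrow> int) \<Rightarrow> nsym" where
  "det_H m a c = (\<Sum>\<tau> | \<tau> permutes {1..m}.
     of_int (sign \<tau>) * (\<Prod>j\<leftarrow>[1..<m + 1]. H (a j + c (\<tau> j))))"

text \<open>Composing \<tau> on the left with the transposition exchanges two columns and keeps the
  order of the rows, so the usual sign-reversing involution works for noncommuting entries.\<close>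

lemma det_H_eq_0:
  assumes "p \<in> {1..m}" "q \<in> {1..m}" "p \<noteq> q" "c p = c q"
  shows "det_H m a c = 0"
proof -
  let ?t = "Transposition.transpose p q"
  let ?f = "\<lambda>\<tau>. of_int (sign \<tau>) * (\<Prod>j\<leftarrow>[1..<m + 1]. H (a j + c (\<tau> j)))"
  have t: "?t permutes {1..m}"
    using assms by (simp add: permutes_swap_id)
  have c: "c (?t x) = c x" for x
    using assms(4) by (auto simp: transpose_def)
  have "det_H m a c = (\<Sum>\<tau> | \<tau> permutes {1..m}. - ?f \<tau>)"
    unfolding det_H_def
  proof (rule sum.reindex_bij_witness[where i = "\<lambda>\<tau>. ?t \<circ> \<tau>" and j = "\<lambda>\<tau>. ?t \<circ> \<tau>"])
    fix \<tau> assume "\<tau> \<in> {\<tau>. \<tau> permutes {1..m}}"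
    then have \<tau>: "\<tau> permutes {1..m}" by simp
    then have "permutation \<tau>"
      by (meson finite_atLeastAtMost permutation_permutes)
    then have "sign (?t \<circ> \<tau>) = - sign \<tau>"
      using assms(3) by (simp add: sign_compose sign_swap_id permutation_swap_id)
    then show "- ?f (?t \<circ> \<tau>) = ?f \<tau>"
      by (simp add: c)
    show "?t \<circ> (?t \<circ> \<tau>) = \<tau>" "?t \<circ> (?t \<circ> \<tau>) = \<tau>"
      by (simp_all add: fun_eq_iff)
    show "?t \<circ> \<tau> \<in> {\<tau>. \<tau> permutes {1..m}}" "?t \<circ> \<tau> \<in> {\<tau>. \<tau> permutes {1..m}}"
      using permutes_compose[OF \<tau> t] by simp_all
  qed
  then have "det_H m a c = - det_H m a c"
    by (simp add: det_H_def sum_negf)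
  \<comment> \<open>That x = -x forces x = 0 is read off the rational coefficients.\<close>
  then have "Poly_Mapping.lookup (det_H m a c) \<beta> = - Poly_Mapping.lookup (det_H m a c) \<beta>" for \<beta>
    by (metis lookup_uminus)
  then show ?thesis
    by (intro poly_mapping_eqI) (simp add: equal_neg_zero)
qed

text \<open>Used contrapositively: a finite set of positive columns that is not an initial segment
  contains some c + 1 but not c, where c \<ge> 1.\<close>

lemma downward_closed_eq_atLeastAtMost:
  fixes W :: "nat set"
  assumes "finite W" "0 \<notin> W" "\<And>c. c \<ge> 1 \<Longrightarrow> Suc c \<in> W \<Longrightarrow> c \<in> W"
  shows "W = {1..card W}"
proof (cases "W = {}")
  case False
  define n where "n = Max W"
  have "n \<in> W"
    unfolding n_def using assms(1) False by (rule Max_in)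
  have 1: "1 \<le> c \<longrightarrow> c \<in> W" if "c \<le> n" for c
    using that
  proof (induction rule: inc_induct)
    case base
    then show ?case using \<open>n \<in> W\<close> by blast
  next
    case (step c)
    then show ?case using assms(3)[of c] by simp
  qed
  have 2: "1 \<le> c \<and> c \<le> n" if "c \<in> W" for c
  proof -
    have "c \<noteq> 0" using that assms(2) by metis
    then show ?thesis
      unfolding n_def using Max_ge[OF assms(1) that] by simp
  qed
  have "W = {1..n}"
    by (rule set_eqI) (metis 1 2 atLeastAtMost_iff)
  moreover from this have "card W = n"
    by (rule ssubst[of W]) simp
  ultimately show ?thesis
    by (simp only:)
qed simp

text \<open>\<open>e_perp i\<close> lowers i columns in all possible ways. Only the choice {1..i}
  avoids two equal columns, and it exists only for i \<le> m.\<close>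

lemma e_perp_det_H:
  "e_perp i (det_H m a int) = (if i \<le> m then det_H m a (\<lambda>c. int c - of_bool (c \<le> i)) else 0)"
proof -
  let ?S = "{U. U \<subseteq> {1..m} \<and> card U = i}"
  let ?c = "\<lambda>W c. int c - of_bool (c \<in> W)"
  have scalar: "e_perp i (of_int (sign \<tau>) * h) = of_int (sign \<tau>) * e_perp i h" for \<tau> :: "nat \<Rightarrow> nat" and h
    by (cases "sign \<tau> = 1") (auto simp: sign_def perp_uminus fundamental_ones_in_QSym)
  have set: "set [1..<m + 1] = {1..m}" by auto
  \<comment> \<open>Taking the image W of the row set U under \<tau> turns the lowering into a
    change of the column labels to \<open>?c W\<close>, the same for all \<tau>. After exchanging
    the sums, each W thus gives a determinant.\<close>
  have reindex: "(\<Sum>U\<in>?S. \<Prod>j\<leftarrow>[1..<m + 1]. H (a j + int (\<tau> j) - of_bool (j \<in> U)))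
      = (\<Sum>W\<in>?S. \<Prod>j\<leftarrow>[1..<m + 1]. H (a j + ?c W (\<tau> j)))" if \<tau>: "\<tau> permutes {1..m}" for \<tau>
  proof (rule sum.reindex_bij_witness[where i = "\<lambda>W. inv \<tau> ` W" and j = "\<lambda>U. \<tau> ` U"])
    have inj: "inj \<tau>" "inj (inv \<tau>)"
      using permutes_inj[OF \<tau>] permutes_inj[OF permutes_inv[OF \<tau>]] by auto
    fix U assume U: "U \<in> ?S"
    show "inv \<tau> ` \<tau> ` U = U" "\<tau> ` inv \<tau> ` U = U"
      using permutes_inverses[OF \<tau>] by (simp_all add: image_image)
    have "\<tau> ` U \<subseteq> \<tau> ` {1..m}" "inv \<tau> ` U \<subseteq> inv \<tau> ` {1..m}"
      using U by blast+
    then show "\<tau> ` U \<in> ?S" "inv \<tau> ` U \<in> ?S"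
      using U inj permutes_image[OF \<tau>] permutes_image[OF permutes_inv[OF \<tau>]]
      by (simp_all add: card_image inj_on_subset)
    show "(\<Prod>j\<leftarrow>[1..<m + 1]. H (a j + ?c (\<tau> ` U) (\<tau> j)))
        = (\<Prod>j\<leftarrow>[1..<m + 1]. H (a j + int (\<tau> j) - of_bool (j \<in> U)))"
      by (simp add: inj_image_mem_iff[OF inj(1)] add_diff_eq)
  qed
  have "e_perp i (det_H m a int) = (\<Sum>\<tau> | \<tau> permutes {1..m}. of_int (sign \<tau>) *
      (\<Sum>W\<in>?S. \<Prod>j\<leftarrow>[1..<m + 1]. H (a j + ?c W (\<tau> j))))"
    unfolding det_H_def perp_sum[OF fundamental_ones_in_QSym] scalar
    by (rule sum.cong[OF refl]) (subst e_perp_prod_list, simp, simp only: set reindex mem_Collect_eq)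
  also have "\<dots> = (\<Sum>W\<in>?S. det_H m a (?c W))"
    unfolding det_H_def sum_distrib_left by (rule sum.swap)
  also have "\<dots> = (\<Sum>W\<in>?S \<inter> {{1..i}}. det_H m a (?c W))"
  proof (rule sum.mono_neutral_right)
    show "\<forall>W\<in>?S - ?S \<inter> {{1..i}}. det_H m a (?c W) = 0"
    proof
      fix W assume W: "W \<in> ?S - ?S \<inter> {{1..i}}"
      then have "W \<noteq> {1..card W}" "finite W" "0 \<notin> W"
        using finite_subset[of W "{1..m}"] by auto
      then obtain c where "c \<ge> 1" "Suc c \<in> W" "c \<notin> W"
        using downward_closed_eq_atLeastAtMost by blast
      \<comment> \<open>Lowering column c + 1 but not column c gives both the label c.\<close>
      then show "det_H m a (?c W) = 0"
        using W by (intro det_H_eq_0[of "Suc c" m c]) auto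
    qed
  qed auto
  also have "?S \<inter> {{1..i}} = (if i \<le> m then {{1..i}} else {})"
    by (auto dest: card_mono[rotated])
  also have "(\<Sum>W\<in>\<dots>. det_H m a (?c W)) = (if i \<le> m then det_H m a (?c {1..i}) else 0)"
    by simp
  \<comment> \<open>The two labellings differ only at 0, which is not a column.\<close>
  also have "det_H m a (?c {1..i}) = det_H m a (\<lambda>c. int c - of_bool (c \<le> i))"
    unfolding det_H_def
  proof (intro sum.cong arg_cong2[of _ _ _ _ "(*)"] arg_cong[of _ _ prod_list] map_cong refl)
    fix \<tau> j assume "\<tau> \<in> {\<tau>. \<tau> permutes {1..m}}" "j \<in> set [1..<m + 1]"
    then have "\<tau> permutes {1..m}" "j \<in> {1..m}" by auto
    then have "\<tau> j \<in> {1..m}"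
      by (simp only: permutes_in_image)
    then show "H (a j + ?c {1..i} (\<tau> j)) = H (a j + (int (\<tau> j) - of_bool (\<tau> j \<le> i)))"
      by simp
  qed
  finally show ?thesis .
qed

section \<open>Laplace expansion along the first row\<close>

text \<open>The cycle with \<open>1 \<mapsto> i + 1\<close> and \<open>j \<mapsto> j - 1\<close> for \<open>2 \<le> j \<le> i + 1\<close>.\<close>

primrec rot :: "nat \<Rightarrow> nat \<Rightarrow> nat" where
  "rot 0 = id"
| "rot (Suc i) = Transposition.transpose (Suc i) (Suc (Suc i)) \<circ> rot i"

lemma rot_1: "rot i (Suc 0) = Suc i"
  by (induction i) auto

lemma rot_Suc:
  assumes "j \<ge> 1"
  shows "rot i (Suc j) = (if j \<le> i then j else Suc j)"
  using assms by (induction i) (auto simp: transpose_def)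

lemma rot_permutes: "rot i permutes {1..Suc i}"
proof (induction i)
  case (Suc i)
  show ?case
    unfolding rot.simps
    by (rule permutes_compose[OF permutes_subset[OF Suc] permutes_swap_id]) auto
qed (simp add: id_def)

lemma sign_rot: "sign (rot i) = (- 1) ^ i"
proof (induction i)
  case (Suc i)
  have "permutation (rot i)"
    using rot_permutes permutation_permutes by blast
  then have "sign (rot (Suc i)) = - sign (rot i)"
    unfolding rot.simps by (simp only: sign_compose sign_swap_id permutation_swap_id) simp
  then show ?case
    using Suc by (metis power_Suc mult_minus1)
qed (simp add: id_def[symmetric])

text \<open>If \<sigma> maps 1 to i + 1, undoing \<open>rot i\<close> leaves a permutation that
  fixes 1, and this is a permutation \<tau> of {1..m} transported along \<open>Suc\<close>.\<close>

lemma bij_betw_permutes_Suc: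
  "bij_betw (\<lambda>(i, \<tau>). rot i \<circ> map_permutation {1..m} Suc \<tau>)
     ({..m} \<times> {\<tau>. \<tau> permutes {1..m}}) {\<sigma>. \<sigma> permutes {1..Suc m}}"
    (is "bij_betw ?f ?A ?B")
proof -
  let ?l = "map_permutation {1..m} Suc"
  have l: "?l \<tau> permutes {2..Suc m}" if "\<tau> permutes {1..m}" for \<tau>
    by (rule map_permutation_permutes[OF _ that]) (auto simp: bij_betw_def image_Suc_atLeastAtMost)
  have sub: "?f ` ?A \<subseteq> ?B"
  proof clarsimp
    fix i \<tau> assume "i \<le> m" "\<tau> permutes {Suc 0..m}"
    then show "rot i \<circ> map_permutation {Suc 0..m} Suc \<tau> permutes {Suc 0..Suc m}"
      using permutes_compose[OF permutes_subset[OF l] permutes_subset[OF rot_permutes]] by simp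
  qed
  have "inj_on ?f ?A"
  proof (rule inj_onI, clarify)
    fix i \<tau> i' \<tau>' assume \<tau>: "\<tau> permutes {1..m}" "\<tau>' permutes {1..m}"
      and eq: "rot i \<circ> ?l \<tau> = rot i' \<circ> ?l \<tau>'"
    \<comment> \<open>Both transported permutations fix 1, so the value of the composite at 1
      determines i.\<close>
    have "?l \<tau> 1 = 1" "?l \<tau>' 1 = 1"
      by (rule permutes_not_in[OF l[OF \<tau>(1)]], simp, rule permutes_not_in[OF l[OF \<tau>(2)]], simp)
    then have i: "i = i'"
      using fun_cong[OF eq, of 1] by (simp add: rot_1)
    then have "?l \<tau> x = ?l \<tau>' x" for x
      using fun_cong[OF eq, of x] permutes_inj[OF rot_permutes, of i'] by (simp add: inj_eq)
    then have "Suc (\<tau> x) = Suc (\<tau>' x)" if "x \<in> {1..m}" for x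
      using map_permutation_apply[of Suc "{1..m}" x] that by (metis inj_Suc inj_on_subset subset_UNIV)
    then show "i = i' \<and> \<tau> = \<tau>'"
      using i \<tau> by (metis ext nat.inject permutes_not_in)
  qed
  \<comment> \<open>Surjectivity follows by counting: (m + 1) * m! = (m + 1)!.\<close>
  moreover have "card ?A = card ?B"
    by (simp add: card_cartesian_product card_permutations[of _ m] card_permutations[of _ "Suc m"])
  then have "?f ` ?A = ?B"
    using card_image[OF \<open>inj_on ?f ?A\<close>] sub by (intro card_subset_eq) (auto simp: finite_permutations)
  ultimately show ?thesis
    by (simp add: bij_betw_def)
qed

text \<open>The factor from the first row stands leftmost in every product, so it can be pulled out
  without commuting H's. If \<sigma> maps 1 to i + 1, the columns left are 1, ..., i, i + 2, ..., m
  + 1, that is \<open>1 + (int c - of_bool (c \<le> i))\<close> for c in {1..m}; the 1 is absorbed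
  into the row parameter.\<close>

lemma det_H_Suc:
  "det_H (Suc m) a int = (\<Sum>i\<le>m. (- 1) ^ i * H (a 1 + int i + 1) *
     det_H m (\<lambda>j. a (Suc j) + 1) (\<lambda>c. int c - of_bool (c \<le> i)))"
proof -
  let ?l = "map_permutation {1..m} Suc"
  let ?f = "\<lambda>\<sigma>. of_int (sign \<sigma>) * (\<Prod>j\<leftarrow>[1..<Suc m + 1]. H (a j + int (\<sigma> j)))"
  let ?g = "\<lambda>i \<tau>. of_int (sign \<tau>) * (\<Prod>j\<leftarrow>[1..<m + 1]. H (a (Suc j) + 1 + (int (\<tau> j) - of_bool (\<tau> j \<le> i))))"
  have upt: "[1..<Suc m + 1] = 1 # map Suc [1..<m + 1]"
    by (simp add: map_Suc_upt upt_conv_Cons del: upt_Suc)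
  have summand: "?f (rot i \<circ> ?l \<tau>) = (- 1) ^ i * H (a 1 + int i + 1) * ?g i \<tau>"
    if \<tau>: "\<tau> permutes {1..m}" for i \<tau>
  proof -
    have l: "?l \<tau> permutes {2..Suc m}"
      by (rule map_permutation_permutes[OF _ \<tau>]) (auto simp: bij_betw_def image_Suc_atLeastAtMost)
    have "sign (?l \<tau>) = sign \<tau>"
      by (rule sign_map_permutation) (use \<tau> in auto)
    then have sign: "sign (rot i \<circ> ?l \<tau>) = (- 1) ^ i * sign \<tau>"
      using l rot_permutes[of i] by (subst sign_compose) (auto simp: sign_rot permutation_permutes)
    have 1: "(rot i \<circ> ?l \<tau>) 1 = Suc i"
      using permutes_not_in[OF l, of 1] by (simp add: rot_1)
    have Suc: "int ((rot i \<circ> ?l \<tau>) (Suc j)) = 1 + (int (\<tau> j) - of_bool (\<tau> j \<le> i))" if "j \<in> {1..m}" for j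
    proof -
      have "?l \<tau> (Suc j) = Suc (\<tau> j)" "\<tau> j \<ge> 1"
        using that permutes_in_image[OF \<tau>, of j] by (auto intro: map_permutation_apply)
      then show ?thesis
        by (simp add: rot_Suc)
    qed
    have prod: "(\<Prod>j\<leftarrow>[1..<Suc m + 1]. H (a j + int ((rot i \<circ> ?l \<tau>) j))) = H (a 1 + int i + 1) *
        (\<Prod>j\<leftarrow>[1..<m + 1]. H (a (Suc j) + 1 + (int (\<tau> j) - of_bool (\<tau> j \<le> i))))"
      unfolding upt list.map prod_list.Cons 1 map_map
    proof (intro arg_cong2[of _ _ _ _ "(*)"] arg_cong[of _ _ prod_list] map_cong refl)
      fix j assume "j \<in> set [1..<m + 1]"
      then have "j \<in> {1..m}" by auto
      then show "((\<lambda>j. H (a j + int ((rot i \<circ> ?l \<tau>) j))) \<circ> Suc) j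
          = H (a (Suc j) + 1 + (int (\<tau> j) - of_bool (\<tau> j \<le> i)))"
        by (simp only: Suc o_apply[of _ Suc] add.assoc)
    qed (simp add: algebra_simps)
    \<comment> \<open>Only the integer s moves past x, and integers are central.\<close>
    have "of_int ((- 1) ^ i * s) * (x * y) = (- 1) ^ i * x * (of_int s * y)"
      for s and x y :: nsym
    proof -
      have "of_int ((- 1) ^ i * s) * (x * y) = (- 1) ^ i * (of_int s * x) * y"
        by (simp add: mult.assoc)
      also have "of_int s * x = x * of_int s"
        by (rule mult_of_int_commute)
      finally show ?thesis
        by (simp only: mult.assoc)
    qed
    then show ?thesis
      by (simp only: sign prod)
  qed
  have "det_H (Suc m) a int = (\<Sum>p\<in>{..m} \<times> {\<tau>. \<tau> permutes {1..m}}. ?f (rot (fst p) \<circ> ?l (snd p)))"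
    unfolding det_H_def
    using sum.reindex_bij_betw[OF bij_betw_permutes_Suc[of m], of ?f, symmetric]
    by (simp only: split_def)
  also have "\<dots> = (\<Sum>i\<le>m. \<Sum>\<tau> | \<tau> permutes {1..m}. ?f (rot i \<circ> ?l \<tau>))"
    by (simp only: sum.cartesian_product split_def)
  also have "\<dots> = (\<Sum>i\<le>m. (- 1) ^ i * H (a 1 + int i + 1) * (\<Sum>\<tau> | \<tau> permutes {1..m}. ?g i \<tau>))"
    unfolding sum_distrib_left by (intro sum.cong refl) (simp only: summand mem_Collect_eq)
  finally show ?thesis
    by (simp only: det_H_def)
qed

section \<open>Immaculate functions as determinants\<close>

text \<open>Induction on \<alpha>: the terms of \<open>bernstein k\<close> applied to the
  determinant of the tail are those of \<open>det_H_Suc\<close>. Rows are counted from 1, so the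
  factor from the new first row has index (k - 1) + i + 1 = k + i.\<close>

lemma immaculate_eq_det_H: "immaculate \<alpha> = det_H (length \<alpha>) (\<lambda>j. \<alpha> ! (j - 1) - int j) int"
proof (induction \<alpha>)
  case Nil
  then show ?case
    by (simp add: immaculate_def det_H_def)
next
  case (Cons k \<alpha>)
  let ?m = "length \<alpha>"
  let ?a = "\<lambda>j. \<alpha> ! (j - 1) - int j"
  let ?t = "\<lambda>i. (- 1) ^ i * H (k + int i) * e_perp i (det_H ?m ?a int)"
  have "immaculate (k # \<alpha>) = Sum_any ?t"
    unfolding Cons[symmetric] by (simp add: immaculate_def bernstein_def)
  also have "\<dots> = (\<Sum>i\<le>?m. ?t i)"
  proof (rule Sum_any.expand_superset)
    show "{i. ?t i \<noteq> 0} \<subseteq> {..?m}"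
      by (auto simp: e_perp_det_H split: if_splits)
  qed simp
  also have "\<dots> = (\<Sum>i\<le>?m. (- 1) ^ i * H (k + int i) * det_H ?m ?a (\<lambda>c. int c - of_bool (c \<le> i)))"
    by (rule sum.cong) (auto simp: e_perp_det_H)
  also have "\<dots> = det_H (Suc ?m) (\<lambda>j. (k # \<alpha>) ! (j - 1) - int j) int"
  proof -
    \<comment> \<open>Renumbering the rows costs -1 in the row parameter, which the +1 from
      \<open>det_H_Suc\<close> cancels.\<close>
    have "det_H ?m (\<lambda>j. (k # \<alpha>) ! (Suc j - 1) - int (Suc j) + 1) c = det_H ?m ?a c" for c
      unfolding det_H_def
      by (intro sum.cong arg_cong2[of _ _ _ _ "(*)"] arg_cong[of _ _ prod_list] map_cong refl)
         (auto simp: nth_Cons')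
    then show ?thesis
      by (simp add: det_H_Suc)
  qed
  finally show ?case by simp
qed

theorem theorem3p27:
  fixes \<alpha> :: "int list" and m :: nat
  assumes "length \<alpha> = m"
  shows "immaculate \<alpha> =
    (\<Sum>\<sigma> | \<sigma> permutes {1..m}.
       of_int (sign \<sigma>) *
       (\<Prod>i\<leftarrow>[1..<m + 1]. H (\<alpha> ! (i - 1) + int (\<sigma> i) - int i)))"
  unfolding immaculate_eq_det_H det_H_def assms by (simp only: diff_add_eq)

end
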